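(* Let $D$ and $\Omega$ be bounded domains with Lipschitz boundaries in $\mathbb{R}^3$ with $\overline{D}\subset\Omega$, and suppose that $\Omega\setminus\overline{D}$ is connected. Let $\mathbf{I}$ denote the $3\times 3$ identity matrix. Suppose that for some constant $k\in\mathbb{R}$ with $k\neq 0$, some constant $c\in\mathbb{R}$ and some constant vector $\mathbf{d}\in\mathbb{R}^3$, the over-determined problem $$ \begin{cases} \Delta w = k & \text{in } \Omega\setminus\overline{D},\\ \nabla w = 0 & \text{on } \partial\Omega,\\ \nabla w(\mathbf{x}) = \mathbf{A}\mathbf{x}+\mathbf{d} & \text{on } \partial D, \end{cases} $$ with $\mathbf{A}=c\,\mathbf{I}$, admits a solution $w$. Then $D$ and $\Omega$ are concentric balls.
   Context: A domain is a nonempty connected open set. The function $w$ is real-valued, defined on the shell $\Omega\setminus\overline{D}$, and the conditions on $\partial\Omega$ and $\partial D$ prescribe the boundary values of the full gradient $\nabla w$, taken from within $\Omega\setminus\overline{D}$. "Concentric balls" means that $D$ and $\Omega$ are open balls with the same center. *)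

theory Defs
  imports "HOL-Analysis.Analysis"
begin

definition bounded_domain :: "'a::euclidean_space set \<Rightarrow> bool" where
  "bounded_domain S \<longleftrightarrow> open S \<and> connected S \<and> S \<noteq> {} \<and> bounded S"

text \<open>
  Near each boundary point, after an orthogonal change of coordinates \<open>T\<close>, the set is
  exactly the region strictly above the graph of a Lipschitz function of the first two
  coordinates.
\<close>

definition lipschitz_boundary :: "(real^3) set \<Rightarrow> bool" where
  "lipschitz_boundary S \<longleftrightarrow>
    (\<forall>p\<in>frontier S. \<exists>(T :: real^3 \<Rightarrow> real^3) (\<gamma> :: real^2 \<Rightarrow> real) L r.
       orthogonal_transformation T \<and> L-lipschitz_on UNIV \<gamma> \<and> r > 0 \<and>
       S \<inter> ball p r = {x \<in> ball p r. T x $ 3 > \<gamma> (vector [T x $ 1, T x $ 2])})"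

definition gradient :: "(real^'n \<Rightarrow> real) \<Rightarrow> real^'n \<Rightarrow> real^'n" where
  "gradient f x = (THE D. GDERIV f x :> D)"

lemma gradient_eqI: "gradient f x = D" if "GDERIV f x :> D"
proof -
  have "E = D" if "GDERIV f x :> E" for E
  proof -
    have "(\<lambda>h. h \<bullet> E) = (\<lambda>h. h \<bullet> D)"
      using that \<open>GDERIV f x :> D\<close> unfolding gderiv_def by (rule has_derivative_unique)
    then show "E = D"
      by (metis inner_commute vector_eq_rdot)
  qed
  with that show ?thesis
    unfolding gradient_def by blast
qed

definition laplacian :: "(real^'n \<Rightarrow> real) \<Rightarrow> real^'n \<Rightarrow> real" where
  "laplacian f x = (\<Sum>i\<in>UNIV. jacobian (gradient f) (at x) $ i $ i)"

text \<open>
  Twice continuous differentiability on an open set \<open>S\<close>. The derivatives are those of the full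
  neighbourhood filter \<open>at x\<close>, so for open \<open>S\<close> the values of \<open>f\<close> outside \<open>S\<close> are irrelevant.
\<close>

definition C2_on :: "(real^'n) set \<Rightarrow> (real^'n \<Rightarrow> real) \<Rightarrow> bool" where
  "C2_on S f \<longleftrightarrow>
    (\<forall>x\<in>S. f differentiable (at x)) \<and>
    (\<forall>x\<in>S. gradient f differentiable (at x)) \<and>
    continuous_on S (\<lambda>x. jacobian (gradient f) (at x))"

end

theory Submission
  imports Defs
begin

text \<open>
  Let \<open>V\<close> be an infinitesimal rigid motion. Since the Laplacian commutes with rigid motions,
  \<open>\<nabla>w \<bullet> V\<close> is harmonic in the shell, so it vanishes by the maximum principle as soon as it
  vanishes on the boundary. If \<open>c \<noteq> 0\<close>, put \<open>a = - d / c\<close>; then this applies to all rotations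
  about \<open>a\<close>, so \<open>w\<close> is radial, \<open>\<nabla>w = (k / 3 + C / \<bar>y\<bar>\<^sup>3) y\<close> with \<open>y = x - a\<close>, and the
  boundary conditions confine both frontiers to spheres around \<open>a\<close>. If \<open>c = 0\<close>, it applies to all
  translations orthogonal to \<open>d\<close>, so \<open>\<nabla>w\<close> is a multiple of a fixed
  unit vector \<open>n\<close>, \<open>\<nabla>w \<bullet> n - k x \<bullet> n\<close> is constant, and the frontier of \<open>\<Omega>\<close> would lie in a plane.
\<close>

section \<open>Auxiliary facts\<close>

lemma gderiv_gradient:
  fixes f :: "real^'n \<Rightarrow> real"
  assumes "f differentiable (at x)"
  shows "GDERIV f x :> gradient f x"
proof -
  obtain f' where f': "(f has_derivative f') (at x)"
    using assms unfolding differentiable_def by blast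
  have "f' h = h \<bullet> adjoint f' 1" for h
    using adjoint_works[OF has_derivative_linear[OF f'], of h 1] by simp
  then have "f' = (\<lambda>h. h \<bullet> adjoint f' 1)"
    by blast
  with f' have "GDERIV f x :> adjoint f' 1"
    unfolding gderiv_def by simp
  with gradient_eqI show ?thesis
    by metis
qed

text \<open>The sum is the trace of \<open>transpose M ** (J ** M)\<close>, and cyclic invariance of
  the trace removes the orthogonal matrix \<open>M\<close>. In this way the Laplacian commutes with
  rigid motions.\<close>

lemma trace_orthogonal_conjugate:
  fixes T :: "real^'n \<Rightarrow> real^'n" and J :: "real^'n^'n"
  assumes "orthogonal_transformation T"
  shows "(\<Sum>i\<in>UNIV. (J *v T (axis i 1)) \<bullet> T (axis i 1)) = trace J"
proof -
  define M where "M = matrix T"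
  have M: "orthogonal_matrix M" "T v = M *v v" for v
    using assms by (auto simp: M_def orthogonal_transformation_matrix)
  have "(J *v T (axis i 1)) \<bullet> T (axis i 1) = (transpose M ** (J ** M)) $ i $ i" for i
  proof -
    have "(J *v T (axis i 1)) \<bullet> T (axis i 1) = ((transpose M ** (J ** M)) *v axis i 1) \<bullet> axis i 1"
      unfolding M(2) matrix_vector_mul_assoc[symmetric] transpose_matrix_vector dot_lmul_matrix ..
    also have "\<dots> = (transpose M ** (J ** M)) $ i $ i"
      by (simp add: inner_axis matrix_vector_mult_basis column_def)
    finally show ?thesis .
  qed
  then have "(\<Sum>i\<in>UNIV. (J *v T (axis i 1)) \<bullet> T (axis i 1)) = trace (transpose M ** (J ** M))"
    by (simp add: trace_def)
  also have "\<dots> = trace ((J ** M) ** transpose M)"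
    by (rule trace_mul_sym)
  also have "\<dots> = trace J"
    using M(1) by (simp add: orthogonal_matrix_def matrix_mul_assoc[symmetric])
  finally show ?thesis .
qed

text \<open>If \<open>c\<close> were positive, \<open>f'\<close> would be positive just to the right
  of its zero at 0, and \<open>f\<close> would strictly increase there.\<close>

lemma second_derivative_nonpos_at_max:
  fixes f f' :: "real \<Rightarrow> real"
  assumes "\<delta> > 0"
    and f: "\<And>t. \<bar>t\<bar> < \<delta> \<Longrightarrow> (f has_real_derivative f' t) (at t)"
    and f': "(f' has_real_derivative c) (at 0)"
    and max: "\<And>t. \<bar>t\<bar> < \<delta> \<Longrightarrow> f t \<le> f 0"
  shows "c \<le> 0"
proof (rule ccontr)
  assume "\<not> c \<le> 0"
  have "f' 0 = 0"
    using DERIV_local_max[OF f[of 0] \<open>\<delta> > 0\<close>] max \<open>\<delta> > 0\<close> by simp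
  obtain e where "e > 0" and e: "\<And>h. 0 < h \<Longrightarrow> h < e \<Longrightarrow> f' 0 < f' (0 + h)"
    using DERIV_pos_inc_right[OF f'] \<open>\<not> c \<le> 0\<close> by force
  define b where "b = min e \<delta> / 2"
  have b: "0 < b" "b < e" "b < \<delta>"
    using \<open>e > 0\<close> \<open>\<delta> > 0\<close> by (auto simp: b_def min_def)
  have "f 0 < f b"
  proof (rule DERIV_pos_imp_increasing_open[OF b(1)])
    show "\<exists>y. (f has_real_derivative y) (at t) \<and> y > 0" if "0 < t" "t < b" for t
      using f[of t] e[of t] b that \<open>f' 0 = 0\<close> by auto
    show "continuous_on {0..b} f"
      using b by (intro continuous_at_imp_continuous_on ballI DERIV_isCont[OF f]) auto
  qed
  with max[of b] b show False
    by simp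
qed

section \<open>Topology of open sets and their frontiers\<close>

text \<open>The tube lemma around the compact slice at time 0. It yields one time span that serves
  all points of \<open>K\<close> at once.\<close>

lemma compact_tube:
  fixes P :: "real \<times> 'a::metric_space \<Rightarrow> bool"
  assumes "open {z. P z}" "compact K" "\<And>x. x \<in> K \<Longrightarrow> P (0, x)"
  obtains \<delta> where "\<delta> > 0" "\<And>s x. \<bar>s\<bar> < \<delta> \<Longrightarrow> x \<in> K \<Longrightarrow> P (s, x)"
proof -
  obtain U V where UV: "open U" "0 \<in> U" "K \<subseteq> V" "U \<times> V \<subseteq> {z. P z}"
    using tube_lemma_right[of euclidean euclidean "{z. P z}" K 0] assms
    by (auto simp: open_openin[symmetric] prod_topology_euclidean)
  obtain \<delta> where "\<delta> > 0" "ball 0 \<delta> \<subseteq> U"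
    using UV openE by blast
  with UV that[of \<delta>] show thesis
    by (auto simp: subset_iff dist_real_def)
qed

text \<open>A connected set that misses the frontier lies inside \<open>S\<close> or outside it. The
  exterior of the closed ball, connected in dimension at least 2, lies outside because
  \<open>S\<close> is bounded; the open ball then contains \<open>S\<close>, so it meets
  \<open>S\<close> and lies inside.\<close>

lemma bounded_open_eq_ball:
  fixes S :: "'a::euclidean_space set"
  assumes "open S" "bounded S" "S \<noteq> {}" "frontier S \<subseteq> sphere a R" "DIM('a) \<ge> 2"
  shows "0 < R \<and> S = ball a R"
proof -
  have "connected (- cball a R)"
    using assms(5) by (intro connected_complement_bounded_convex) auto
  moreover have "- cball a R \<inter> frontier S = {}"
    using assms(4) by (auto simp: dist_commute)
  moreover have "\<not> - cball a R \<subseteq> S"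
    using assms(2) bounded_subset cobounded_imp_unbounded by (metis bounded_cball)
  ultimately have "- cball a R \<inter> S = {}"
    using connected_Int_frontier[of "- cball a R" S] by blast
  then have "S \<subseteq> interior (cball a R)"
    using assms(1) by (intro interior_maximal) auto
  then have sub: "S \<subseteq> ball a R"
    by simp
  with assms(3) have "0 < R"
    by (metis ball_eq_empty not_less subset_empty)
  have "ball a R \<inter> frontier S = {}"
    using assms(4) by auto
  with sub assms(3) have "ball a R \<subseteq> S"
    using connected_Int_frontier[of "ball a R" S] by blast
  with sub \<open>0 < R\<close> show ?thesis
    by blast
qed

text \<open>A nonzero linear functional attains its extrema over the compact closure only on the
  frontier, since every point of \<open>S\<close> can be moved a little along \<open>n\<close> or
  \<open>- n\<close>. One such move inside \<open>S\<close> shows that the two extrema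
  differ.\<close>

lemma bounded_open_inner_not_constant_on_frontier:
  fixes S :: "'a::euclidean_space set"
  assumes "open S" "bounded S" "S \<noteq> {}" "n \<noteq> 0"
  obtains p q where "p \<in> frontier S" "q \<in> frontier S" "p \<bullet> n < q \<bullet> n"
proof -
  have step: "\<exists>t>0. x + t *\<^sub>R v \<in> S" if "x \<in> S" for x v
  proof -
    have "((\<lambda>t. x + t *\<^sub>R v) \<longlongrightarrow> x + 0 *\<^sub>R v) (at_right 0)"
      by (intro tendsto_intros)
    then have "eventually (\<lambda>t. x + t *\<^sub>R v \<in> S) (at_right 0)"
      using topological_tendstoD[OF _ assms(1)] that by auto
    then have "eventually (\<lambda>t. x + t *\<^sub>R v \<in> S \<and> t > 0) (at_right (0::real))"
      using eventually_at_right_less by (rule eventually_conj)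
    then show ?thesis
      using eventually_happens'[of "at_right (0::real)"] by auto
  qed
  have ex: "\<exists>q\<in>frontier S. \<forall>x\<in>closure S. x \<bullet> v \<le> q \<bullet> v" if "v \<noteq> 0" for v
  proof -
    have "\<exists>q\<in>closure S. \<forall>x\<in>closure S. x \<bullet> v \<le> q \<bullet> v"
      using assms(2,3) by (intro continuous_attains_sup continuous_intros) (auto simp: compact_closure)
    then obtain q where q: "q \<in> closure S" "\<And>x. x \<in> closure S \<Longrightarrow> x \<bullet> v \<le> q \<bullet> v"
      by blast
    have "q \<notin> S"
    proof
      assume "q \<in> S"
      then obtain t where "t > 0" "q + t *\<^sub>R v \<in> S"
        using step by blast
      then have "(q + t *\<^sub>R v) \<bullet> v \<le> q \<bullet> v"
        using q closure_subset by blast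
      with \<open>t > 0\<close> have "v \<bullet> v \<le> 0"
        by (simp add: inner_add_left mult_le_0_iff)
      with \<open>v \<noteq> 0\<close> show False
        by (metis inner_gt_zero_iff not_less)
    qed
    with q assms(1) show ?thesis
      by (auto simp: frontier_def interior_open)
  qed
  obtain q where q: "q \<in> frontier S" "\<And>x. x \<in> closure S \<Longrightarrow> x \<bullet> n \<le> q \<bullet> n"
    using ex[OF assms(4)] by blast
  obtain p where p: "p \<in> frontier S" "\<And>x. x \<in> closure S \<Longrightarrow> p \<bullet> n \<le> x \<bullet> n"
    using ex[of "- n"] assms(4) by auto
  obtain x t where x: "x \<in> S" "t > 0" "x + t *\<^sub>R n \<in> S"
    using assms(3) step by blast
  have "p \<bullet> n \<le> x \<bullet> n" "(x + t *\<^sub>R n) \<bullet> n \<le> q \<bullet> n"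
    using x p q closure_subset by blast+
  moreover have "x \<bullet> n < (x + t *\<^sub>R n) \<bullet> n"
    using x assms(4) by (simp add: inner_add_left)
  ultimately show thesis
    using that p q by force
qed

text \<open>
  Without a condition of this kind the frontier could contain points invisible from outside, such
  as the center of a punctured ball.
\<close>

lemma lipschitz_boundary_frontier_closure:
  assumes "lipschitz_boundary S" "open S" "p \<in> frontier S"
  shows "p \<in> closure (- closure S)"
proof -
  obtain T :: "real^3 \<Rightarrow> real^3" and \<gamma> :: "real^2 \<Rightarrow> real" and L r where
    T: "orthogonal_transformation T" and \<gamma>: "L-lipschitz_on UNIV \<gamma>" and "r > 0"
    and S: "S \<inter> ball p r = {x \<in> ball p r. T x $ 3 > \<gamma> (vector [T x $ 1, T x $ 2])}"
    using assms(1,3) unfolding lipschitz_boundary_def by meson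
  have "linear T"
    using T by (rule orthogonal_transformation_linear)
  then have contT: "continuous_on A T" for A
    by (rule linear_continuous_on[OF linear_conv_bounded_linear[THEN iffD1]])
  have cont: "continuous_on UNIV (\<lambda>x. \<gamma> (vector [T x $ 1, T x $ 2]))"
  proof (rule continuous_on_compose2[OF lipschitz_on_continuous_on[OF \<gamma>]])
    have "(\<lambda>x. vector [T x $ 1, T x $ 2] :: real^2) =
        (\<lambda>x. T x $ 1 *\<^sub>R axis 1 1 + T x $ 2 *\<^sub>R axis 2 1)"
      by (auto simp: vec_eq_iff forall_2 axis_def)
    then show "continuous_on UNIV (\<lambda>x. vector [T x $ 1, T x $ 2] :: real^2)"
      by (simp only:) (intro continuous_intros contT)
  qed auto
  \<comment> \<open>\<open>U\<close> is the part of the ball strictly below the graph.\<close>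
  define U where "U = {x. T x $ 3 < \<gamma> (vector [T x $ 1, T x $ 2])} \<inter> ball p r"
  have "open U"
    unfolding U_def by (intro open_Int open_Collect_less cont continuous_intros contT) auto
  moreover have "U \<inter> S = {}"
    using S[THEN equalityD1, THEN subsetD] by (force simp: U_def)
  ultimately have U: "U \<subseteq> - closure S"
    by (metis Int_commute disjoint_eq_subset_Compl open_Int_closure_eq_empty inf_commute)
  obtain v where v: "T v = axis 3 1"
    using orthogonal_transformation_surj[OF T] by (metis surjD)
  have "norm v = 1"
    using T v by (metis norm_axis_1 orthogonal_transformation_norm)
  have "p \<notin> S"
    using assms(2,3) by (simp add: frontier_def interior_open)
  with S \<open>r > 0\<close> have le: "T p $ 3 \<le> \<gamma> (vector [T p $ 1, T p $ 2])"
    by (force simp: not_less[symmetric])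
  \<comment> \<open>\<open>p\<close> lies on or below the graph, and \<open>T\<close> maps
    \<open>v\<close> to the vertical direction, so subtracting a small multiple of \<open>v\<close>
    moves \<open>p\<close> strictly below.\<close>
  have "p - s *\<^sub>R v \<in> U" if "0 < s" "s < r" for s
  proof -
    have "T (p - s *\<^sub>R v) = T p - s *\<^sub>R axis 3 1"
      using \<open>linear T\<close> v by (simp add: linear_diff linear_scale)
    with le that \<open>norm v = 1\<close> show ?thesis
      by (simp add: U_def axis_def dist_norm)
  qed
  then have "eventually (\<lambda>s. p - s *\<^sub>R v \<in> closure (- closure S)) (at_right 0)"
    using U closure_subset \<open>r > 0\<close> by (intro eventually_at_rightI[of 0 r]) (auto, blast)
  moreover have "((\<lambda>s. p - s *\<^sub>R v) \<longlongrightarrow> p - 0 *\<^sub>R v) (at_right 0)"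
    by (intro tendsto_intros)
  ultimately show ?thesis
    using Lim_in_closed_set[of "closure (- closure S)" _ "at_right (0::real)"] by simp
qed


section \<open>Rigid motions acting on solutions of the Poisson equation\<close>

text \<open>\<open>G\<close> and \<open>J\<close> are the gradient and the Hessian of
  \<open>w\<close>, kept as parameters so that arguments use \<open>has_derivative\<close>
  directly.\<close>

locale poisson_equation =
  fixes S :: "(real^'n) set" and w :: "real^'n \<Rightarrow> real"
    and G :: "real^'n \<Rightarrow> real^'n" and J :: "real^'n \<Rightarrow> real^'n^'n" and k :: real
  assumes open_S: "open S"
    and grad: "x \<in> S \<Longrightarrow> (w has_derivative (\<lambda>h. h \<bullet> G x)) (at x)"
    and hess: "x \<in> S \<Longrightarrow> (G has_derivative (\<lambda>h. J x *v h)) (at x)"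
    and trace_hess: "x \<in> S \<Longrightarrow> trace (J x) = k"
begin

lemma continuous_on_G: "continuous_on S G"
  using hess has_derivative_continuous continuous_at_imp_continuous_on by blast

lemma continuous_on_w: "continuous_on S w"
  using grad has_derivative_continuous continuous_at_imp_continuous_on by blast

end

text \<open>By \<open>flow_add\<close> each \<open>\<phi> s\<close> is affine with linear part
  \<open>T s\<close>, hence a rigid motion; by \<open>flow\<close> its orbits are integral curves of
  \<open>V\<close>.\<close>

locale rigid_flow =
  fixes T :: "real \<Rightarrow> real^'n \<Rightarrow> real^'n" and \<phi> :: "real \<Rightarrow> real^'n \<Rightarrow> real^'n"
    and V :: "real^'n \<Rightarrow> real^'n"
  assumes orth: "orthogonal_transformation (T s)"
    and flow_add: "\<phi> s (x + h) = \<phi> s x + T s h"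
    and flow_0: "\<phi> 0 x = x"
    and flow: "((\<lambda>s. \<phi> s x) has_vector_derivative V (\<phi> s x)) (at s)"
    and continuous_flow: "continuous_on UNIV (\<lambda>z. \<phi> (fst z) (snd z))"
    and continuous_V: "continuous_on UNIV V"
begin

lemma bounded_linear_T: "bounded_linear (T s)"
  using orthogonal_transformation_linear[OF orth] by (simp add: linear_conv_bounded_linear)

lemma flow_has_derivative: "(\<phi> s has_derivative T s) (at x)"
proof -
  have "\<phi> s = (\<lambda>y. \<phi> s 0 + T s y)"
    by (rule ext) (metis add_0 flow_add)
  moreover have "((\<lambda>y. \<phi> s 0 + T s y) has_derivative T s) (at x)"
    using bounded_linear_imp_has_derivative[OF bounded_linear_T]
    by (auto intro!: derivative_eq_intros)
  ultimately show ?thesis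
    by simp
qed

lemma continuous_on_flow [continuous_intros]:
  assumes "continuous_on A f" "continuous_on A g"
  shows "continuous_on A (\<lambda>x. \<phi> (f x) (g x))"
  using continuous_on_compose2[OF continuous_flow continuous_on_Pair[OF assms]] by simp

text \<open>Running time backwards replaces \<open>V\<close> by \<open>- V\<close>, which turns an
  upper bound for \<open>G x \<bullet> V x\<close> into a lower one.\<close>

lemma rigid_flow_reverse: "rigid_flow (\<lambda>s. T (- s)) (\<lambda>s. \<phi> (- s)) (\<lambda>x. - V x)"
proof
  show "((\<lambda>s. \<phi> (- s) x) has_vector_derivative - V (\<phi> (- s) x)) (at s)" for s x
  proof -
    have "(uminus has_vector_derivative - 1) (at s)"
      by (auto simp: has_vector_derivative_def intro!: derivative_eq_intros)
    from vector_diff_chain_at[OF this flow] show ?thesis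
      by (simp add: o_def)
  qed
  show "continuous_on UNIV (\<lambda>z. \<phi> (- fst z) (snd z))"
    by (intro continuous_intros)
qed (auto simp: orth flow_add flow_0 intro!: continuous_intros continuous_V)

end

section \<open>Maximum principle for the derivative of \<open>w\<close> along a rigid flow\<close>

locale poisson_flow = poisson_equation S w G J k + rigid_flow T \<phi> V
  for S :: "(real^'n) set" and w G J k
    and T \<phi> :: "real \<Rightarrow> real^'n \<Rightarrow> real^'n" and V
begin

text \<open>Supplies the open conditions for \<open>compact_tube\<close>: the orbit is still in
  \<open>S\<close> at the given time, and a continuous error \<open>r\<close> is small.\<close>

lemma open_preimage:
  fixes r :: "real \<times> (real^'n) \<Rightarrow> real"
  assumes "continuous_on {z. snd z \<in> S \<and> \<phi> (fst z) (snd z) \<in> S} r"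
  shows "open {z. snd z \<in> S \<and> \<phi> (fst z) (snd z) \<in> S \<and> r z < \<eta>}"
proof -
  let ?A = "{z. snd z \<in> S \<and> \<phi> (fst z) (snd z) \<in> S}"
  have "open (snd -` S \<inter> (\<lambda>z. \<phi> (fst z) (snd z)) -` S)"
    using open_S by (intro open_Int open_vimage continuous_flow continuous_intros)
  also have "snd -` S \<inter> (\<lambda>z. \<phi> (fst z) (snd z)) -` S = ?A"
    by auto
  finally have "open (?A \<inter> r -` {..<\<eta>})"
    using assms by (intro continuous_open_preimage) auto
  also have "?A \<inter> r -` {..<\<eta>} = {z. snd z \<in> S \<and> \<phi> (fst z) (snd z) \<in> S \<and> r z < \<eta>}"
    by auto
  finally show ?thesis .
qed

lemma w_along_flow:
  assumes "\<phi> s x \<in> S"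
  shows "((\<lambda>s. w (\<phi> s x)) has_real_derivative G (\<phi> s x) \<bullet> V (\<phi> s x)) (at s)"
proof -
  have "((\<lambda>s. \<phi> s x) has_derivative (\<lambda>h. h *\<^sub>R V (\<phi> s x))) (at s)"
    using flow by (simp add: has_vector_derivative_def)
  from has_derivative_compose[OF this grad[OF assms]] show ?thesis
    by (simp add: has_field_derivative_def inner_commute mult.commute[of _ "_ \<bullet> _"])
qed

text \<open>Used twice: to compare difference quotients with \<open>G \<bullet> V\<close> uniformly
  on a compact set, and to show that \<open>w\<close> is constant along orbits when
  \<open>G \<bullet> V\<close> vanishes.\<close>

lemma flow_mean_value:
  assumes "0 < s" "\<And>\<sigma>. 0 \<le> \<sigma> \<Longrightarrow> \<sigma> \<le> s \<Longrightarrow> \<phi> \<sigma> x \<in> S"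
  obtains \<sigma> where "0 < \<sigma>" "\<sigma> < s" "w (\<phi> s x) - w x = s * (G (\<phi> \<sigma> x) \<bullet> V (\<phi> \<sigma> x))"
proof -
  have "\<exists>\<sigma>. 0 < \<sigma> \<and> \<sigma> < s \<and>
      w (\<phi> s x) - w (\<phi> 0 x) = (s - 0) * (G (\<phi> \<sigma> x) \<bullet> V (\<phi> \<sigma> x))"
    using assms by (intro MVT2 w_along_flow) auto
  then show thesis
    using that by (auto simp: flow_0)
qed

text \<open>
  The difference quotients of \<open>w\<close> along the flow are harmonic and converge to \<open>G \<bullet> V\<close>, uniformly
  on compact sets. Working with them avoids third derivatives of \<open>w\<close>.
\<close>

lemma difference_quotient_no_max:
  assumes "0 < s" "0 < \<epsilon>" "0 < \<rho>"
    and sub: "ball y \<rho> \<subseteq> S" "\<phi> s ` ball y \<rho> \<subseteq> S"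
    and max: "\<And>x. x \<in> ball y \<rho> \<Longrightarrow>
      (w (\<phi> s x) - w x) / s + \<epsilon> * (x \<bullet> x) \<le> (w (\<phi> s y) - w y) / s + \<epsilon> * (y \<bullet> y)"
  shows False
proof -
  define f where "f = (\<lambda>x. (w (\<phi> s x) - w x) / s + \<epsilon> * (x \<bullet> x))"
  \<comment> \<open>Second derivative test on the line through \<open>y\<close> in direction
    \<open>e\<close>; the last summand comes from
    \<open>\<epsilon> * (x \<bullet> x)\<close>.\<close>
  have le: "((J (\<phi> s y) *v T s e) \<bullet> T s e - (J y *v e) \<bullet> e) / s + \<epsilon> * (2 * 1) \<le> 0"
    if "norm e = 1" for e
  proof (rule second_derivative_nonpos_at_max[OF \<open>0 < \<rho>\<close>])
    define L where "L = (\<lambda>t. y + t *\<^sub>R e)"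
    have L: "(L has_derivative (\<lambda>t. t *\<^sub>R e)) (at t)" for t
      unfolding L_def by (auto intro!: derivative_eq_intros)
    have \<phi>L: "((\<lambda>t. \<phi> s (L t)) has_derivative (\<lambda>t. t *\<^sub>R T s e)) (at t)" for t
      using has_derivative_compose[OF L flow_has_derivative]
      by (simp add: linear_scale[OF orthogonal_transformation_linear[OF orth]])
    have inS: "L t \<in> S" "\<phi> s (L t) \<in> S" and inB: "L t \<in> ball y \<rho>" if "\<bar>t\<bar> < \<rho>" for t
    proof -
      show "L t \<in> ball y \<rho>"
        using that \<open>norm e = 1\<close> by (simp add: L_def dist_norm)
      then show "L t \<in> S" "\<phi> s (L t) \<in> S"
        using sub by blast+
    qed
    have ee: "e \<bullet> e = 1"
      using that by (simp add: dot_square_norm)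
    show "((\<lambda>t. f (L t)) has_real_derivative
        (T s e \<bullet> G (\<phi> s (L t)) - e \<bullet> G (L t)) / s + \<epsilon> * (2 * (L t \<bullet> e))) (at t)"
      if "\<bar>t\<bar> < \<rho>" for t
    proof -
      have "((\<lambda>t. w (\<phi> s (L t))) has_real_derivative T s e \<bullet> G (\<phi> s (L t))) (at t)"
        using has_derivative_compose[OF \<phi>L grad[OF inS(2)[OF that]]]
        by (simp add: has_field_derivative_def mult.commute[of _ "_ \<bullet> _"])
      moreover have "((\<lambda>t. w (L t)) has_real_derivative e \<bullet> G (L t)) (at t)"
        using has_derivative_compose[OF L grad[OF inS(1)[OF that]]]
        by (simp add: has_field_derivative_def mult.commute[of _ "_ \<bullet> _"])
      moreover have "((\<lambda>t. L t \<bullet> L t) has_real_derivative 2 * (L t \<bullet> e)) (at t)"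
        unfolding has_field_derivative_def
        by (rule derivative_eq_intros L refl)+ (auto simp: fun_eq_iff inner_commute)
      ultimately show ?thesis
        unfolding f_def by (intro DERIV_add DERIV_cdivide DERIV_diff DERIV_cmult)
    qed
    have "L 0 = y" "y \<in> S" "\<phi> s y \<in> S"
      using inS[of 0] \<open>0 < \<rho>\<close> by (auto simp: L_def)
    then have G0: "((\<lambda>t. G (L t)) has_derivative (\<lambda>t. J y *v (t *\<^sub>R e))) (at 0)"
      "((\<lambda>t. G (\<phi> s (L t))) has_derivative (\<lambda>t. J (\<phi> s y) *v (t *\<^sub>R T s e))) (at 0)"
      using has_derivative_compose[OF L, of G _ 0] has_derivative_compose[OF \<phi>L, of G _ 0] hess
      by auto
    have "((\<lambda>t. T s e \<bullet> G (\<phi> s (L t))) has_real_derivative (J (\<phi> s y) *v T s e) \<bullet> T s e) (at 0)"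
      using has_derivative_inner_right[OF G0(2), of "T s e"]
      by (simp add: has_field_derivative_def matrix_vector_mult_scaleR inner_commute
          mult.commute[of _ "_ \<bullet> _"])
    moreover have "((\<lambda>t. e \<bullet> G (L t)) has_real_derivative (J y *v e) \<bullet> e) (at 0)"
      using has_derivative_inner_right[OF G0(1), of e]
      by (simp add: has_field_derivative_def matrix_vector_mult_scaleR inner_commute
          mult.commute[of _ "_ \<bullet> _"])
    moreover have "((\<lambda>t. L t \<bullet> e) has_real_derivative 1) (at 0)"
      using has_derivative_inner_left[OF L[of 0], of e]
      unfolding has_field_derivative_def lambda_one[symmetric] by (simp add: ee)
    ultimately show "((\<lambda>t. (T s e \<bullet> G (\<phi> s (L t)) - e \<bullet> G (L t)) / s + \<epsilon> * (2 * (L t \<bullet> e)))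
        has_real_derivative
        ((J (\<phi> s y) *v T s e) \<bullet> T s e - (J y *v e) \<bullet> e) / s + \<epsilon> * (2 * 1)) (at 0)"
      by (intro DERIV_add DERIV_cdivide DERIV_diff DERIV_cmult)
    show "f (L t) \<le> f (L 0)" if "\<bar>t\<bar> < \<rho>" for t
      using max[OF inB[OF that]] by (simp add: f_def L_def)
  qed
  have "y \<in> S" "\<phi> s y \<in> S"
    using sub \<open>0 < \<rho>\<close> by auto
  \<comment> \<open>Summed over the standard basis, the second derivatives of \<open>w\<close> give
    \<open>k - k = 0\<close>, and only a positive multiple of \<open>\<epsilon>\<close>
    remains.\<close>
  have "(\<Sum>i\<in>UNIV. ((J (\<phi> s y) *v T s (axis i 1)) \<bullet> T s (axis i 1) - (J y *v axis i 1) \<bullet> axis i 1) / s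
      + \<epsilon> * (2 * 1)) \<le> 0"
    by (intro sum_nonpos le) (simp add: norm_axis_1)
  also have "(\<Sum>i\<in>UNIV. ((J (\<phi> s y) *v T s (axis i 1)) \<bullet> T s (axis i 1) - (J y *v axis i 1) \<bullet> axis i 1) / s
      + \<epsilon> * (2 * 1)) = (trace (J (\<phi> s y)) - trace (J y)) / s + real CARD('n) * (\<epsilon> * (2 * 1))"
    using trace_orthogonal_conjugate[OF orth, of "J (\<phi> s y)" s]
      trace_orthogonal_conjugate[OF orthogonal_transformation_id, of "J y"]
    by (simp add: sum.distrib sum_subtractf sum_divide_distrib[symmetric])
  finally show False
    using trace_hess[OF \<open>y \<in> S\<close>] trace_hess[OF \<open>\<phi> s y \<in> S\<close>] \<open>0 < \<epsilon>\<close>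
    by (simp add: mult_le_0_iff)
qed

text \<open>Maximum principle by contradiction. If \<open>u = G \<bullet> V\<close> has a value
  \<open>2 * m > 0\<close>, then \<open>u \<ge> m\<close> holds on a compact subset \<open>K\<close>
  of \<open>S\<close>, where the difference quotients for some small \<open>s\<close> differ from
  \<open>u\<close> by less than \<open>m / 8\<close>. Perturbed by
  \<open>\<epsilon> * (x \<bullet> x)\<close>, such a quotient attains its maximum over
  \<open>K\<close> at an interior point of \<open>K\<close>, which
  \<open>difference_quotient_no_max\<close> forbids.\<close>

lemma flow_derivative_nonpos:
  assumes "bounded S"
    and bdry: "\<And>p. p \<in> frontier S \<Longrightarrow> ((\<lambda>x. G x \<bullet> V x) \<longlongrightarrow> 0) (at p within S)"
    and "x0 \<in> S"
  shows "G x0 \<bullet> V x0 \<le> 0"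
proof (rule ccontr)
  define u where "u = (\<lambda>x. G x \<bullet> V x)"
  define m where "m = u x0 / 2"
  assume "\<not> G x0 \<bullet> V x0 \<le> 0"
  then have "m > 0" "u x0 = 2 * m"
    by (auto simp: u_def m_def)
  have cont_u: "continuous_on S u"
    unfolding u_def by (intro continuous_intros continuous_on_G continuous_on_subset[OF continuous_V]) auto
  define K where "K = {x \<in> S. u x \<ge> m}"
  have "K \<subseteq> S" "x0 \<in> K"
    using \<open>x0 \<in> S\<close> \<open>m > 0\<close> \<open>u x0 = 2 * m\<close> by (auto simp: K_def)
  \<comment> \<open>A limit of points of \<open>K\<close> outside \<open>S\<close> would be a
    frontier point, where \<open>u\<close> tends to 0 and not to a value at least
    \<open>m\<close>.\<close>
  have "closed K"
  proof (unfold closed_sequential_limits, safe, rule ccontr)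
    fix X l assume X: "\<forall>n. X n \<in> K" "X \<longlonglongrightarrow> l" and "l \<notin> K"
    have XS: "X n \<in> S" "u (X n) \<ge> m" for n
      using X by (auto simp: K_def)
    have "l \<in> closure S"
      using XS X(2) closure_sequential by blast
    show False
    proof (cases "l \<in> S")
      case True
      then have "(\<lambda>n. u (X n)) \<longlonglongrightarrow> u l"
        using continuous_on_tendsto_compose[OF cont_u X(2)] XS by simp
      then have "m \<le> u l"
        using XS by (intro LIMSEQ_le_const) auto
      with True \<open>l \<notin> K\<close> show False
        by (simp add: K_def)
    next
      case False
      with \<open>l \<in> closure S\<close> have "l \<in> frontier S"
        by (simp add: frontier_def interior_open open_S)
      moreover have "filterlim X (at l within S) sequentially"
        using X(2) XS False by (auto simp: filterlim_at intro!: always_eventually)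
      ultimately have "(\<lambda>n. u (X n)) \<longlonglongrightarrow> 0"
        using filterlim_compose[OF bdry] by (simp add: u_def)
      then have "m \<le> 0"
        using XS by (intro LIMSEQ_le_const) auto
      with \<open>m > 0\<close> show False
        by simp
    qed
  qed
  then have "compact K"
    using \<open>bounded S\<close> \<open>K \<subseteq> S\<close> bounded_subset compact_eq_bounded_closed by blast
  obtain B where "B > 0" and B: "\<And>x. x \<in> S \<Longrightarrow> norm x \<le> B"
    using \<open>bounded S\<close> unfolding bounded_pos by blast
  \<comment> \<open>Chosen so that the perturbation is at most \<open>m / 4\<close> on
    \<open>S\<close>.\<close>
  define \<epsilon> where "\<epsilon> = m / (4 * B\<^sup>2)"
  have "\<epsilon> > 0"
    using \<open>m > 0\<close> \<open>B > 0\<close> by (simp add: \<epsilon>_def)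
  have \<epsilon>_le: "\<epsilon> * (x \<bullet> x) \<le> m / 4" if "x \<in> S" for x
  proof -
    have "\<epsilon> * (x \<bullet> x) \<le> \<epsilon> * B\<^sup>2"
      using B[OF that] \<open>\<epsilon> > 0\<close> by (simp add: dot_square_norm power_mono)
    with \<open>B > 0\<close> show ?thesis
      by (simp add: \<epsilon>_def)
  qed
  define P where "P = (\<lambda>z. snd z \<in> S \<and> \<phi> (fst z) (snd z) \<in> S \<and>
    \<bar>u (\<phi> (fst z) (snd z)) - u (snd z)\<bar> < m / 8)"
  have "open {z. P z}"
    unfolding P_def
    by (intro open_preimage continuous_intros continuous_on_compose2[OF cont_u]) auto
  moreover have "P (0, x)" if "x \<in> K" for x
    using that \<open>K \<subseteq> S\<close> \<open>m > 0\<close> by (auto simp: P_def flow_0)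
  ultimately obtain \<delta> where "\<delta> > 0" and \<delta>: "\<And>s x. \<bar>s\<bar> < \<delta> \<Longrightarrow> x \<in> K \<Longrightarrow> P (s, x)"
    using compact_tube[of P K] \<open>compact K\<close> by blast
  define s where "s = \<delta> / 2"
  have s: "0 < s" "s < \<delta>"
    using \<open>\<delta> > 0\<close> by (auto simp: s_def)
  have inS: "\<phi> \<sigma> x \<in> S" if "x \<in> K" "0 \<le> \<sigma>" "\<sigma> \<le> s" for \<sigma> x
    using \<delta>[of \<sigma> x] that s by (simp add: P_def)
  have near: "\<bar>(w (\<phi> s x) - w x) / s - u x\<bar> < m / 8" if x: "x \<in> K" for x
  proof -
    obtain \<sigma> where \<sigma>: "0 < \<sigma>" "\<sigma> < s" "w (\<phi> s x) - w x = s * u (\<phi> \<sigma> x)"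
      using flow_mean_value[of s x] s(1) inS[OF x] unfolding u_def by blast
    with \<delta>[of \<sigma> x] x s show ?thesis
      by (simp add: P_def)
  qed
  define f where "f = (\<lambda>x. (w (\<phi> s x) - w x) / s + \<epsilon> * (x \<bullet> x))"
  have "continuous_on K f"
    unfolding f_def using \<open>K \<subseteq> S\<close> inS s
    by (intro continuous_intros continuous_on_compose2[OF continuous_on_w]) auto
  then obtain y where "y \<in> K" and y: "\<And>x. x \<in> K \<Longrightarrow> f x \<le> f y"
    using continuous_attains_sup[OF \<open>compact K\<close>] \<open>x0 \<in> K\<close> by blast
  have "y \<in> S"
    using \<open>y \<in> K\<close> \<open>K \<subseteq> S\<close> by blast
  \<comment> \<open>The errors \<open>m / 8\<close>, \<open>m / 8\<close> and \<open>m / 4\<close>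
    add up to \<open>m / 2\<close>, so \<open>u y\<close> is at least \<open>3 * m / 2\<close>; a
    whole ball around \<open>y\<close> therefore lies in \<open>K\<close>.\<close>
  have "2 * m - m / 8 \<le> f x0"
    using near[OF \<open>x0 \<in> K\<close>] \<open>u x0 = 2 * m\<close> \<open>\<epsilon> > 0\<close> unfolding f_def
    using mult_nonneg_nonneg[of \<epsilon> "x0 \<bullet> x0"] inner_ge_zero[of x0] unfolding f_def
    by linarith
  also have "\<dots> \<le> f y"
    by (rule y[OF \<open>x0 \<in> K\<close>])
  also have "\<dots> \<le> u y + m / 8 + m / 4"
    using near[OF \<open>y \<in> K\<close>] \<epsilon>_le[OF \<open>y \<in> S\<close>] unfolding f_def by linarith
  finally have "u y > m"
    using \<open>m > 0\<close> by simp
  have "open (S \<inter> u -` {m<..})"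
    using cont_u open_S by (intro continuous_open_preimage) auto
  then obtain \<rho> where "\<rho> > 0" and \<rho>: "ball y \<rho> \<subseteq> S \<inter> u -` {m<..}"
    using \<open>y \<in> S\<close> \<open>u y > m\<close> openE[of "S \<inter> u -` {m<..}" y] by auto
  then have "ball y \<rho> \<subseteq> K"
    by (auto simp: K_def)
  show False
  proof (rule difference_quotient_no_max[OF \<open>0 < s\<close> \<open>0 < \<epsilon>\<close> \<open>0 < \<rho>\<close>])
    show "ball y \<rho> \<subseteq> S" "\<phi> s ` ball y \<rho> \<subseteq> S"
      using \<rho> \<open>ball y \<rho> \<subseteq> K\<close> inS s(1) by (blast, force)
    show "(w (\<phi> s x) - w x) / s + \<epsilon> * (x \<bullet> x) \<le> (w (\<phi> s y) - w y) / s + \<epsilon> * (y \<bullet> y)"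
      if "x \<in> ball y \<rho>" for x
      using y[unfolded f_def] that \<open>ball y \<rho> \<subseteq> K\<close> by blast
  qed
qed

lemma flow_derivative_zero:
  assumes "bounded S"
    and bdry: "\<And>p. p \<in> frontier S \<Longrightarrow> ((\<lambda>x. G x \<bullet> V x) \<longlongrightarrow> 0) (at p within S)"
    and "x \<in> S"
  shows "G x \<bullet> V x = 0"
proof (rule antisym)
  show "G x \<bullet> V x \<le> 0"
    using assms by (rule flow_derivative_nonpos)
  interpret rev: poisson_flow S w G J k "\<lambda>s. T (- s)" "\<lambda>s. \<phi> (- s)" "\<lambda>x. - V x"
    by (intro poisson_flow.intro poisson_equation_axioms rigid_flow_reverse)
  have "((\<lambda>x. G x \<bullet> - V x) \<longlongrightarrow> 0) (at p within S)" if "p \<in> frontier S" for p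
    using tendsto_minus[OF bdry[OF that]] by (simp only: inner_minus_right minus_zero)
  then have "G x \<bullet> - V x \<le> 0"
    using assms(1,3) by (intro rev.flow_derivative_nonpos)
  then show "0 \<le> G x \<bullet> V x"
    by simp
qed

section \<open>Symmetry of the gradient under a flow that preserves \<open>w\<close>\<close>

text \<open>The mean value theorem makes \<open>w\<close> constant along orbits in \<open>S\<close>,
  so \<open>w (\<phi> s y) = w y\<close> for all \<open>y\<close> near \<open>x\<close> and small
  \<open>s\<close>. Differentiating this in \<open>y\<close> gives the relation.\<close>

lemma gradient_equivariant:
  assumes zero: "\<And>x. x \<in> S \<Longrightarrow> G x \<bullet> V x = 0" and "x \<in> S"
  shows "eventually (\<lambda>s. \<forall>h. G (\<phi> s x) \<bullet> T s h = G x \<bullet> h) (at_right 0)"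
proof -
  obtain \<rho> where "\<rho> > 0" and \<rho>: "cball x \<rho> \<subseteq> S"
    using open_S \<open>x \<in> S\<close> open_contains_cball by blast
  define P where "P = (\<lambda>z. snd z \<in> S \<and> \<phi> (fst z) (snd z) \<in> S \<and> (0::real) < 1)"
  have "open {z. P z}"
    unfolding P_def by (intro open_preimage continuous_intros)
  moreover have "P (0, y)" if "y \<in> cball x \<rho>" for y
    using that \<rho> by (auto simp: P_def flow_0)
  ultimately obtain \<delta> where "\<delta> > 0" and \<delta>: "\<And>s y. \<bar>s\<bar> < \<delta> \<Longrightarrow> y \<in> cball x \<rho> \<Longrightarrow> P (s, y)"
    using compact_tube[of P "cball x \<rho>"] compact_cball by blast
  have "\<forall>h. G (\<phi> s x) \<bullet> T s h = G x \<bullet> h" if s: "0 < s" "s < \<delta>" for s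
  proof -
    have inS: "\<phi> \<sigma> y \<in> S" if "y \<in> cball x \<rho>" "0 \<le> \<sigma>" "\<sigma> \<le> s" for \<sigma> y
      using \<delta>[of \<sigma> y] that s by (simp add: P_def)
    have w_eq: "w (\<phi> s y) = w y" if y: "y \<in> cball x \<rho>" for y
    proof -
      obtain \<sigma> where \<sigma>: "0 < \<sigma>" "\<sigma> < s" "w (\<phi> s y) - w y = s * (G (\<phi> \<sigma> y) \<bullet> V (\<phi> \<sigma> y))"
        using flow_mean_value[of s y] s(1) inS[OF y] by blast
      with zero[OF inS[OF y, of \<sigma>]] show ?thesis
        by simp
    qed
    have "((\<lambda>y. w (\<phi> s y)) has_derivative (\<lambda>h. T s h \<bullet> G (\<phi> s x))) (at x)"
      using \<open>\<rho> > 0\<close> s by (intro has_derivative_compose[OF flow_has_derivative grad] inS) auto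
    then have "(w has_derivative (\<lambda>h. T s h \<bullet> G (\<phi> s x))) (at x)"
      by (rule has_derivative_transform_within_open[of _ _ _ _ "ball x \<rho>"])
        (use \<open>\<rho> > 0\<close> w_eq in auto)
    then have "(\<lambda>h. T s h \<bullet> G (\<phi> s x)) = (\<lambda>h. h \<bullet> G x)"
      using grad[OF \<open>x \<in> S\<close>] by (rule has_derivative_unique)
    then show ?thesis
      by (metis inner_commute)
  qed
  with \<open>\<delta> > 0\<close> show ?thesis
    by (intro eventually_at_rightI[of 0 \<delta>]) auto
qed

text \<open>\<open>q' (V x)\<close> is the derivative of \<open>q\<close> along the orbit at time 0,
  computed from the right, where the difference quotients eventually vanish.\<close>

lemma derivative_zero_of_flow_invariant:
  fixes q :: "real^'n \<Rightarrow> real"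
  assumes q: "(q has_derivative q') (at x)"
    and inv: "eventually (\<lambda>s. q (\<phi> s x) = q x) (at_right 0)"
  shows "q' (V x) = 0"
proof -
  have q0: "(q has_derivative q') (at (\<phi> 0 x))"
    using q by (simp only: flow_0)
  have "((\<lambda>s. \<phi> s x) has_derivative (\<lambda>h. h *\<^sub>R V x)) (at 0)"
    using flow[of x 0] by (simp only: has_vector_derivative_def flow_0)
  from has_derivative_compose[OF this q0]
  have "((\<lambda>s. q (\<phi> s x)) has_derivative (\<lambda>h. q' (V x) * h)) (at 0)"
    by (simp only: linear_scale[OF has_derivative_linear[OF q]] real_scaleR_def mult.commute)
  then have "((\<lambda>s. q (\<phi> s x)) has_real_derivative q' (V x)) (at 0)"
    by (simp only: has_field_derivative_def)
  then have "((\<lambda>s. (q (\<phi> s x) - q x) / s) \<longlongrightarrow> q' (V x)) (at 0)"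
    by (simp only: DERIV_def add_0_left flow_0)
  then have "((\<lambda>s. (q (\<phi> s x) - q x) / s) \<longlongrightarrow> q' (V x)) (at_right 0)"
    by (rule tendsto_mono[OF at_le[OF subset_UNIV]])
  moreover have "((\<lambda>s. (q (\<phi> s x) - q x) / s) \<longlongrightarrow> 0) (at_right 0)"
    using inv by (intro tendsto_eventually) (auto elim: eventually_mono)
  ultimately show ?thesis
    using tendsto_unique[OF trivial_limit_at_right_real] by blast
qed

end


section \<open>Translations and rotations\<close>

lemma rigid_flow_translation: "rigid_flow (\<lambda>s x. x) (\<lambda>s x. x + s *\<^sub>R e) (\<lambda>x. e)"
  by unfold_locales
    (auto simp: orthogonal_transformation_def has_vector_derivative_def
      intro!: derivative_eq_intros continuous_intros)

text \<open>For orthonormal \<open>e\<close> and \<open>f\<close> this is the rotation by the angle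
  \<open>s\<close> in their plane, from \<open>e\<close> towards \<open>f\<close>, fixing the
  orthogonal complement. Writing it as a displacement of \<open>x\<close> avoids completing
  \<open>e\<close>, \<open>f\<close> to a basis.\<close>

definition plane_rotation :: "'a::real_inner \<Rightarrow> 'a \<Rightarrow> real \<Rightarrow> 'a \<Rightarrow> 'a" where
  "plane_rotation e f s x = x + ((cos s - 1) * (x \<bullet> e) - sin s * (x \<bullet> f)) *\<^sub>R e
     + (sin s * (x \<bullet> e) + (cos s - 1) * (x \<bullet> f)) *\<^sub>R f"

lemma orthogonal_transformation_plane_rotation:
  fixes e f :: "'a::real_inner"
  assumes "e \<bullet> e = 1" "f \<bullet> f = 1" "e \<bullet> f = 0"
  shows "orthogonal_transformation (plane_rotation e f s)"
proof -
  have fe: "f \<bullet> e = 0"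
    using assms(3) by (simp add: inner_commute)
  have "linear (plane_rotation e f s)"
    by (intro linearI) (simp_all add: plane_rotation_def algebra_simps)
  moreover have "plane_rotation e f s x \<bullet> plane_rotation e f s y = x \<bullet> y" for x y
  proof -
    define C S where "C = cos s" and "S = sin s"
    have CS: "C\<^sup>2 + S\<^sup>2 = 1"
      by (simp add: C_def S_def)
    define x1 x2 y1 y2 where xy: "x1 = x \<bullet> e" "x2 = x \<bullet> f" "y1 = y \<bullet> e" "y2 = y \<bullet> f"
    \<comment> \<open>The coefficients along \<open>e\<close> and \<open>f\<close> of the
      displacements of \<open>x\<close> and \<open>y\<close>.\<close>
    define \<alpha> \<beta> \<alpha>' \<beta>' where ab: "\<alpha> = (C - 1) * x1 - S * x2" "\<beta> = S * x1 + (C - 1) * x2"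
      "\<alpha>' = (C - 1) * y1 - S * y2" "\<beta>' = S * y1 + (C - 1) * y2"
    have "plane_rotation e f s x \<bullet> plane_rotation e f s y
        = (x + \<alpha> *\<^sub>R e + \<beta> *\<^sub>R f) \<bullet> (y + \<alpha>' *\<^sub>R e + \<beta>' *\<^sub>R f)"
      by (simp add: plane_rotation_def ab xy C_def S_def)
    also have "\<dots> = x \<bullet> y + \<alpha>' * x1 + \<beta>' * x2 + \<alpha> * y1 + \<beta> * y2 + \<alpha> * \<alpha>' + \<beta> * \<beta>'"
      by (simp add: inner_add_left inner_add_right assms fe xy inner_commute[of e y] inner_commute[of f y]
          algebra_simps)
    also have "\<dots> = x \<bullet> y + (C\<^sup>2 + S\<^sup>2 - 1) * (x1 * y1 + x2 * y2)"
      unfolding ab by algebra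
    finally show ?thesis
      by (simp add: CS)
  qed
  ultimately show ?thesis
    by (simp add: orthogonal_transformation_def)
qed

text \<open>The field is the infinitesimal rotation about \<open>a\<close>: project
  \<open>x - a\<close> to the plane of \<open>e\<close> and \<open>f\<close> and turn by a right
  angle.\<close>

lemma rigid_flow_plane_rotation:
  fixes e f a :: "real^'n"
  assumes ef: "e \<bullet> e = 1" "f \<bullet> f = 1" "e \<bullet> f = 0"
  shows "rigid_flow (plane_rotation e f) (\<lambda>s x. a + plane_rotation e f s (x - a))
    (\<lambda>x. ((x - a) \<bullet> e) *\<^sub>R f - ((x - a) \<bullet> f) *\<^sub>R e)"
proof
  have fe: "f \<bullet> e = 0"
    using ef(3) by (simp add: inner_commute)
  show "orthogonal_transformation (plane_rotation e f s)" for s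
    by (rule orthogonal_transformation_plane_rotation[OF ef])
  then show "a + plane_rotation e f s (x + h - a) = a + plane_rotation e f s (x - a) + plane_rotation e f s h"
    for s x h
    by (metis (no_types) add_diff_eq diff_add_eq add.assoc orthogonal_transformation_linear linear_add)
  show "a + plane_rotation e f 0 (x - a) = x" for x
    by (simp add: plane_rotation_def)
  show "((\<lambda>s. a + plane_rotation e f s (x - a)) has_vector_derivative
      ((a + plane_rotation e f s (x - a) - a) \<bullet> e) *\<^sub>R f
      - ((a + plane_rotation e f s (x - a) - a) \<bullet> f) *\<^sub>R e) (at s)" for s x
  proof -
    define y1 y2 where y: "y1 = (x - a) \<bullet> e" "y2 = (x - a) \<bullet> f"
    have "((\<lambda>s. a + plane_rotation e f s (x - a)) has_vector_derivative
        (- sin s * y1 - cos s * y2) *\<^sub>R e + (cos s * y1 - sin s * y2) *\<^sub>R f) (at s)"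
      unfolding plane_rotation_def y[symmetric] has_vector_derivative_def
      by (rule derivative_eq_intros refl)+ (simp add: fun_eq_iff algebra_simps)
    moreover have eqs: "plane_rotation e f s (x - a) \<bullet> e = cos s * y1 - sin s * y2"
      "plane_rotation e f s (x - a) \<bullet> f = sin s * y1 + cos s * y2"
      unfolding plane_rotation_def inner_add_left inner_scaleR_left ef fe y[symmetric]
      by (simp_all add: algebra_simps)
    ultimately show ?thesis
      unfolding add_diff_cancel_left' eqs by (simp add: algebra_simps)
  qed
  show "continuous_on UNIV (\<lambda>z. a + plane_rotation e f (fst z) (snd z - a))"
    unfolding plane_rotation_def by (intro continuous_intros)
  show "continuous_on UNIV (\<lambda>x. ((x - a) \<bullet> e) *\<^sub>R f - ((x - a) \<bullet> f) *\<^sub>R e)"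
    by (intro continuous_intros)
qed

text \<open>The vanishing 2 by 2 minors say that \<open>y\<close> and \<open>d\<close> are parallel;
  without division this also covers \<open>y = 0\<close>.\<close>

lemma parallel_vec:
  fixes d y :: "real^'n"
  assumes "\<And>i j. i \<noteq> j \<Longrightarrow> y $ i * d $ j = y $ j * d $ i"
  shows "(y \<bullet> y) *\<^sub>R d = (d \<bullet> y) *\<^sub>R y"
proof -
  have "y $ i * d $ j = y $ j * d $ i" for i j
    using assms by (cases "i = j") auto
  then have "(\<Sum>j\<in>UNIV. y $ j * y $ j) * d $ i = (\<Sum>j\<in>UNIV. d $ j * y $ j) * y $ i" for i
    unfolding sum_distrib_right by (intro sum.cong refl) (metis mult.assoc mult.commute)
  then show ?thesis
    by (simp add: vec_eq_iff inner_vec_def)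
qed

section \<open>Solutions whose boundary gradients are unidirectional or radial\<close>

context poisson_equation
begin

text \<open>Translation along \<open>e\<close> has the constant field \<open>e\<close>, orthogonal
  to every boundary value \<open>b *\<^sub>R n\<close>. Once \<open>G \<bullet> e\<close> vanishes,
  \<open>G\<close> itself is locally constant along \<open>e\<close>.\<close>

lemma translation_invariance:
  assumes "bounded S" "norm n = 1"
    and bdry: "\<And>p. p \<in> frontier S \<Longrightarrow> \<exists>b. (G \<longlongrightarrow> b *\<^sub>R n) (at p within S)"
    and "x \<in> S" "e \<bullet> n = 0"
  shows "G x \<bullet> e = 0"
    and "((\<lambda>x. G x \<bullet> n) has_derivative q') (at x) \<Longrightarrow> q' e = 0"
proof -
  interpret poisson_flow S w G J k "\<lambda>s x. x" "\<lambda>s x. x + s *\<^sub>R e" "\<lambda>x. e"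
    by (intro poisson_flow.intro poisson_equation_axioms rigid_flow_translation)
  have "((\<lambda>x. G x \<bullet> e) \<longlongrightarrow> 0) (at p within S)" if p: "p \<in> frontier S" for p
  proof -
    obtain b where "(G \<longlongrightarrow> b *\<^sub>R n) (at p within S)"
      using bdry[OF p] by blast
    then have "((\<lambda>x. G x \<bullet> e) \<longlongrightarrow> (b *\<^sub>R n) \<bullet> e) (at p within S)"
      by (intro tendsto_intros)
    then show ?thesis
      using \<open>e \<bullet> n = 0\<close> by (simp add: inner_commute)
  qed
  note zero = flow_derivative_zero[OF \<open>bounded S\<close> this]
  show "G x \<bullet> e = 0"
    using zero \<open>x \<in> S\<close> by blast
  show "q' e = 0" if "((\<lambda>x. G x \<bullet> n) has_derivative q') (at x)"
    using that eventually_mono[OF gradient_equivariant[OF zero \<open>x \<in> S\<close>]]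
    by (rule derivative_zero_of_flow_invariant) auto
qed

text \<open>The rotation field about \<open>a\<close> is orthogonal to \<open>p - a\<close> at
  \<open>p\<close>, hence to the boundary values of \<open>G\<close>. For the second claim,
  rotations carry both \<open>G x\<close> and \<open>x - a\<close> along, so their inner product is
  invariant.\<close>

lemma rotation_invariance:
  assumes "bounded S" "i \<noteq> j"
    and bdry: "\<And>p. p \<in> frontier S \<Longrightarrow> \<exists>b. (G \<longlongrightarrow> b *\<^sub>R (p - a)) (at p within S)"
    and "x \<in> S"
  shows "(x - a) $ i * G x $ j = (x - a) $ j * G x $ i"
    and "((\<lambda>x. G x \<bullet> (x - a)) has_derivative (\<lambda>h. h \<bullet> d)) (at x) \<Longrightarrow>
      (x - a) $ i * d $ j = (x - a) $ j * d $ i"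
proof -
  let ?e = "axis i 1 :: real^'n" and ?f = "axis j 1 :: real^'n"
  let ?V = "\<lambda>x. ((x - a) \<bullet> ?e) *\<^sub>R ?f - ((x - a) \<bullet> ?f) *\<^sub>R ?e"
  have ef: "?e \<bullet> ?e = 1" "?f \<bullet> ?f = 1" "?e \<bullet> ?f = 0"
    using \<open>i \<noteq> j\<close> by (simp_all add: inner_axis_axis)
  interpret poisson_flow S w G J k "plane_rotation ?e ?f" "\<lambda>s x. a + plane_rotation ?e ?f s (x - a)" ?V
    by (intro poisson_flow.intro poisson_equation_axioms rigid_flow_plane_rotation ef)
  have V: "v \<bullet> ?V y = (y - a) $ i * v $ j - (y - a) $ j * v $ i" for v y
    by (simp only: inner_diff_right inner_scaleR_right inner_axis inner_real_def mult_1_right)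
  have "((\<lambda>x. G x \<bullet> ?V x) \<longlongrightarrow> 0) (at p within S)" if p: "p \<in> frontier S" for p
  proof -
    obtain b where "(G \<longlongrightarrow> b *\<^sub>R (p - a)) (at p within S)"
      using bdry[OF p] by blast
    then have "((\<lambda>x. G x \<bullet> ?V x) \<longlongrightarrow> (b *\<^sub>R (p - a)) \<bullet> ?V p) (at p within S)"
      by (intro tendsto_intros)
    then show ?thesis
      unfolding V by (simp add: mult.commute mult.left_commute)
  qed
  note zero = flow_derivative_zero[OF \<open>bounded S\<close> this]
  show "(x - a) $ i * G x $ j = (x - a) $ j * G x $ i"
    using zero[OF _ \<open>x \<in> S\<close>] unfolding V by simp
  show "(x - a) $ i * d $ j = (x - a) $ j * d $ i"
    if d: "((\<lambda>x. G x \<bullet> (x - a)) has_derivative (\<lambda>h. h \<bullet> d)) (at x)"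
  proof -
    have "?V x \<bullet> d = 0"
      using d eventually_mono[OF gradient_equivariant[OF zero \<open>x \<in> S\<close>]]
      by (rule derivative_zero_of_flow_invariant) auto
    then show ?thesis
      using V[of d x] by (simp add: inner_commute)
  qed
qed

lemma gradient_inner_differentiable:
  assumes "x \<in> S" "(v has_derivative v') (at x)"
  shows "((\<lambda>x. G x \<bullet> v x) has_derivative (\<lambda>h. h \<bullet> gradient (\<lambda>x. G x \<bullet> v x) x)) (at x)"
proof -
  have "(\<lambda>x. G x \<bullet> v x) differentiable (at x)"
    using has_derivative_inner[OF hess[OF assms(1)] assms(2)] by (rule differentiableI)
  then show ?thesis
    using gderiv_gradient unfolding gderiv_def by blast
qed

lemma trace_hess_axis: "x \<in> S \<Longrightarrow> (\<Sum>i\<in>UNIV. (J x *v axis i 1) $ i) = k"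
  using trace_hess by (simp add: trace_def matrix_vector_mult_basis column_def)

text \<open>\<open>G = q *\<^sub>R n\<close>, where the derivative of \<open>q\<close> vanishes
  orthogonally to \<open>n\<close>. The Hessian thus has rank at most one, and its trace
  \<open>n \<bullet> d\<close> must be \<open>k\<close>.\<close>

lemma unidirectional_gradient:
  assumes "bounded S" "norm n = 1"
    and bdry: "\<And>p. p \<in> frontier S \<Longrightarrow> \<exists>b. (G \<longlongrightarrow> b *\<^sub>R n) (at p within S)"
    and "x \<in> S"
  shows "((\<lambda>x. G x \<bullet> n) has_derivative (\<lambda>h. k * (h \<bullet> n))) (at x)"
proof -
  note inv = translation_invariance[OF assms(1,2) bdry]
  define q where "q = (\<lambda>x. G x \<bullet> n)"
  define d where "d = gradient q x"
  have nn: "n \<bullet> n = 1"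
    using assms(2) by (simp add: dot_square_norm)
  have perp: "(h - (h \<bullet> n) *\<^sub>R n) \<bullet> n = 0" for h
    by (simp add: inner_diff_left nn)
  have q: "(q has_derivative (\<lambda>h. h \<bullet> d)) (at x)"
    unfolding q_def d_def by (rule gradient_inner_differentiable[OF \<open>x \<in> S\<close> has_derivative_const])
  have qh: "h \<bullet> d = (h \<bullet> n) * (n \<bullet> d)" for h
    using inv(2)[OF _ \<open>x \<in> S\<close> perp[of h] q[unfolded q_def]] by (simp add: inner_diff_left)
  have G: "G y = q y *\<^sub>R n" if "y \<in> S" for y
  proof -
    have "G y \<bullet> h = (q y *\<^sub>R n) \<bullet> h" for h
    proof -
      have "G y \<bullet> h - (h \<bullet> n) * (G y \<bullet> n) = 0"
        using inv(1)[OF _ that perp[of h]] by (simp only: inner_diff_right inner_scaleR_right)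
      moreover have "(q y *\<^sub>R n) \<bullet> h = (h \<bullet> n) * (G y \<bullet> n)"
        unfolding inner_scaleR_left q_def inner_commute[of n h] by (rule mult.commute)
      ultimately show ?thesis
        by linarith
    qed
    then show ?thesis
      using vector_eq_rdot by blast
  qed
  have "((\<lambda>y. q y *\<^sub>R n) has_derivative (\<lambda>h. (h \<bullet> d) *\<^sub>R n)) (at x)"
    by (intro has_derivative_scaleR_left q)
  then have "(G has_derivative (\<lambda>h. (h \<bullet> d) *\<^sub>R n)) (at x)"
    using open_S \<open>x \<in> S\<close> by (rule has_derivative_transform_within_open) (simp add: G)
  then have J: "J x *v h = (h \<bullet> d) *\<^sub>R n" for h
    by (rule has_derivative_unique[OF hess[OF \<open>x \<in> S\<close>], THEN fun_cong])
  have "n \<bullet> d = k"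
    using trace_hess_axis[OF \<open>x \<in> S\<close>] unfolding J
    by (simp add: inner_vec_def[of n] inner_axis' mult.commute)
  then have "h \<bullet> d = k * (h \<bullet> n)" for h
    using qh[of h] by (simp only: mult.commute)
  with q show ?thesis
    by (simp only: q_def)
qed

text \<open>With \<open>r = norm (x - a)\<close> and \<open>q = G x \<bullet> (x - a)\<close> as a
  function of \<open>r\<close>, this is the radial Poisson equation
  \<open>r * q' = k * r^2 - (CARD('n) - 2) * q\<close>, in vector form and multiplied by
  \<open>x - a\<close> so that \<open>x = a\<close> is included.\<close>

lemma radial_gradient:
  assumes "bounded S"
    and bdry: "\<And>p. p \<in> frontier S \<Longrightarrow> \<exists>b. (G \<longlongrightarrow> b *\<^sub>R (p - a)) (at p within S)"
    and "x \<in> S"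
  obtains d where "((\<lambda>x. G x \<bullet> (x - a)) has_derivative (\<lambda>h. h \<bullet> d)) (at x)"
    "((x - a) \<bullet> (x - a)) *\<^sub>R d =
      (k * ((x - a) \<bullet> (x - a)) - (real CARD('n) - 2) * (G x \<bullet> (x - a))) *\<^sub>R (x - a)"
proof -
  note inv = rotation_invariance[OF assms(1) _ bdry]
  define q where "q = (\<lambda>x. G x \<bullet> (x - a))"
  define d where "d = gradient q x"
  have id: "((\<lambda>x. x - a) has_derivative (\<lambda>h. h)) (at x)"
    by (auto intro!: derivative_eq_intros)
  have q: "(q has_derivative (\<lambda>h. h \<bullet> d)) (at x)"
    unfolding q_def d_def by (rule gradient_inner_differentiable[OF \<open>x \<in> S\<close> id])
  have d: "((x - a) \<bullet> (x - a)) *\<^sub>R d = (d \<bullet> (x - a)) *\<^sub>R (x - a)"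
    using inv(2)[OF _ _ \<open>x \<in> S\<close>] q unfolding q_def by (intro parallel_vec) blast
  have G: "((y - a) \<bullet> (y - a)) *\<^sub>R G y = q y *\<^sub>R (y - a)" if "y \<in> S" for y
    unfolding q_def using inv(1)[OF _ _ that] by (intro parallel_vec) blast
  \<comment> \<open>Both sides of the identity \<open>G\<close> are differentiated; comparison
    expresses the Hessian by \<open>q\<close> and \<open>d\<close>.\<close>
  have "((\<lambda>y. ((y - a) \<bullet> (y - a)) *\<^sub>R G y) has_derivative
      (\<lambda>h. ((x - a) \<bullet> (x - a)) *\<^sub>R (J x *v h) + (2 * (h \<bullet> (x - a))) *\<^sub>R G x)) (at x)"
    by (rule derivative_eq_intros id hess[OF \<open>x \<in> S\<close>] refl)+ (auto simp: inner_commute)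
  moreover have "((\<lambda>y. q y *\<^sub>R (y - a)) has_derivative (\<lambda>h. q x *\<^sub>R h + (h \<bullet> d) *\<^sub>R (x - a))) (at x)"
    by (rule has_derivative_scaleR[OF q id])
  then have "((\<lambda>y. ((y - a) \<bullet> (y - a)) *\<^sub>R G y) has_derivative
      (\<lambda>h. q x *\<^sub>R h + (h \<bullet> d) *\<^sub>R (x - a))) (at x)"
    using open_S \<open>x \<in> S\<close> by (rule has_derivative_transform_within_open) (simp add: G)
  ultimately have eq: "((x - a) \<bullet> (x - a)) *\<^sub>R (J x *v h) + (2 * (h \<bullet> (x - a))) *\<^sub>R G x
      = q x *\<^sub>R h + (h \<bullet> d) *\<^sub>R (x - a)" for h
    by (rule has_derivative_unique[THEN fun_cong])
  \<comment> \<open>The diagonal entries, to be summed to the trace.\<close>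
  have "((x - a) \<bullet> (x - a)) * (J x *v axis i 1) $ i + 2 * ((x - a) $ i * G x $ i)
      = q x + d $ i * (x - a) $ i" for i
    using arg_cong[OF eq[of "axis i 1"], of "\<lambda>v. v $ i"]
    by (simp add: inner_axis' algebra_simps)
  then have "(\<Sum>i\<in>UNIV. ((x - a) \<bullet> (x - a)) * (J x *v axis i 1) $ i + 2 * ((x - a) $ i * G x $ i))
      = (\<Sum>i\<in>UNIV. q x + d $ i * (x - a) $ i)"
    by (rule sum.cong[OF refl])
  then have "((x - a) \<bullet> (x - a)) * k + 2 * ((x - a) \<bullet> G x) = real CARD('n) * q x + d \<bullet> (x - a)"
    by (simp only: sum.distrib sum_distrib_left[symmetric] trace_hess_axis[OF \<open>x \<in> S\<close>]
        inner_vec_def inner_real_def sum_constant of_nat_mult)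
  then have "d \<bullet> (x - a) = k * ((x - a) \<bullet> (x - a)) - (real CARD('n) - 2) * (G x \<bullet> (x - a))"
    by (simp add: q_def algebra_simps inner_commute)
  with d q that[of d] show thesis
    by (simp add: q_def)
qed

end

text \<open>
  The constant is the \<open>C\<close> in \<open>G x = (k / 3 + C / \<bar>y\<bar>\<^sup>3) y\<close>, \<open>y = x - a\<close>. Avoiding the division
  makes the conclusion meaningful also for \<open>p = a\<close>.
\<close>

lemma radial_frontier_constant:
  fixes S :: "(real^3) set"
  assumes "poisson_equation S w G J k" "bounded S" "connected S"
    and bdry: "\<And>p. p \<in> frontier S \<Longrightarrow> \<exists>b. (G \<longlongrightarrow> b *\<^sub>R (p - a)) (at p within S)"
  obtains C where "\<And>p b. p \<in> frontier S \<Longrightarrow> (G \<longlongrightarrow> b *\<^sub>R (p - a)) (at p within S) \<Longrightarrow>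
    norm (p - a) ^ 3 * (b - k / 3) = C"
proof -
  interpret poisson_equation S w G J k
    by fact
  \<comment> \<open>In dimension 3 the radial equation reads \<open>r * q' = k * r^2 - q\<close>, so
    \<open>r * q - k / 3 * r^3\<close> is a first integral; this is \<open>F\<close>.\<close>
  define F where "F = (\<lambda>x. norm (x - a) * (G x \<bullet> (x - a) - k / 3 * ((x - a) \<bullet> (x - a))))"
  have F': "(F has_derivative (\<lambda>h. 0)) (at x)" if "x \<in> S - {a}" for x
  proof -
    have "x \<in> S"
      using that by simp
    obtain d where q: "((\<lambda>x. G x \<bullet> (x - a)) has_derivative (\<lambda>h. h \<bullet> d)) (at x)"
      and d: "((x - a) \<bullet> (x - a)) *\<^sub>R d =
        (k * ((x - a) \<bullet> (x - a)) - (real CARD(3) - 2) * (G x \<bullet> (x - a))) *\<^sub>R (x - a)"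
      by (rule radial_gradient[OF assms(2) bdry \<open>x \<in> S\<close>])
    define y N Q where "y = x - a" and "N = norm y" and "Q = G x \<bullet> y"
    have "N \<noteq> 0" and yy: "y \<bullet> y = N\<^sup>2"
      using that by (auto simp: y_def N_def dot_square_norm)
    have dh: "N\<^sup>2 * (h \<bullet> d) = (k * N\<^sup>2 - Q) * (h \<bullet> y)" for h
      using arg_cong[OF d, of "\<lambda>v. h \<bullet> v"] unfolding y_def[symmetric] Q_def[symmetric] yy by simp
    have id: "((\<lambda>x. x - a) has_derivative (\<lambda>h. h)) (at x)"
      by (auto intro!: derivative_eq_intros)
    have "((\<lambda>x. norm (x - a)) has_derivative (\<lambda>h. h \<bullet> sgn y)) (at x)"
      using has_derivative_compose[OF id has_derivative_norm] that by (simp add: y_def)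
    moreover have "((\<lambda>x. (x - a) \<bullet> (x - a)) has_derivative (\<lambda>h. 2 * (h \<bullet> y))) (at x)"
      using has_derivative_inner[OF id id] by (simp add: y_def inner_commute)
    ultimately have "(F has_derivative
        (\<lambda>h. N * (h \<bullet> d - k / 3 * (2 * (h \<bullet> y))) + (h \<bullet> sgn y) * (Q - k / 3 * N\<^sup>2))) (at x)"
      unfolding F_def N_def Q_def y_def dot_square_norm[symmetric]
      by (intro has_derivative_mult has_derivative_diff has_derivative_mult_right q)
    moreover have "N * (h \<bullet> d - k / 3 * (2 * (h \<bullet> y))) + (h \<bullet> sgn y) * (Q - k / 3 * N\<^sup>2) = 0" for h
    proof -
      have "h \<bullet> sgn y = (h \<bullet> y) / N"
        by (simp add: sgn_div_norm N_def divide_inverse mult.commute)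
      moreover have "h \<bullet> d = (k * N\<^sup>2 - Q) * (h \<bullet> y) / N\<^sup>2"
        using dh[of h] \<open>N \<noteq> 0\<close> by (simp add: field_simps)
      ultimately show ?thesis
        using \<open>N \<noteq> 0\<close> by (simp only:) (simp add: field_simps power2_eq_square)
    qed
    ultimately show ?thesis
      by simp
  qed
  \<comment> \<open>The norm is not differentiable at 0, so \<open>a\<close> is removed; in
    dimension 3 the open set stays connected.\<close>
  have "connected (S - {a})"
    using open_S assms(3) by (intro connected_open_delete) auto
  moreover have "open (S - {a})"
    using open_S by (intro open_delete)
  ultimately obtain C where C: "\<And>x. x \<in> S - {a} \<Longrightarrow> F x = C"
    using has_derivative_zero_unique_connected[of "S - {a}" F] F' by (metis all_not_in_conv)
  have "norm (p - a) ^ 3 * (b - k / 3) = C"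
    if p: "p \<in> frontier S" and lim: "(G \<longlongrightarrow> b *\<^sub>R (p - a)) (at p within S)" for p b
  proof -
    have "p \<in> closure S - S"
      using p open_S by (simp add: frontier_def interior_open)
    then have "at p within S \<noteq> bot"
      by (simp add: at_within_eq_bot_iff)
    moreover have "(F \<longlongrightarrow> norm (p - a) *
        ((b *\<^sub>R (p - a)) \<bullet> (p - a) - k / 3 * ((p - a) \<bullet> (p - a)))) (at p within S)"
      unfolding F_def by (intro tendsto_intros lim)
    moreover have "eventually (\<lambda>x. x \<in> S \<and> x \<noteq> a) (at p within S)"
      by (intro eventually_conj eventually_neq_at_within) (simp add: eventually_at_filter)
    then have "eventually (\<lambda>x. F x = C) (at p within S)"
      by (rule eventually_mono) (auto intro: C)
    then have "(F \<longlongrightarrow> C) (at p within S)"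
      by (rule tendsto_eventually)
    ultimately have "norm (p - a) * ((b *\<^sub>R (p - a)) \<bullet> (p - a) - k / 3 * ((p - a) \<bullet> (p - a))) = C"
      by (rule tendsto_unique)
    then show ?thesis
      unfolding inner_scaleR_left dot_square_norm
      by (simp only: power2_eq_square power3_eq_cube) (simp add: algebra_simps)
  qed
  then show thesis
    using that by blast
qed

section \<open>The overdetermined problem\<close>

theorem theorem1p1:
  fixes D \<Omega> :: "(real^3) set"
    and w :: "real^3 \<Rightarrow> real"
    and k c :: real
    and d :: "real^3"
    and A :: "real^3^3"
  assumes "bounded_domain D" and "lipschitz_boundary D"
    and "bounded_domain \<Omega>" and "lipschitz_boundary \<Omega>"
    and "closure D \<subseteq> \<Omega>"
    and "connected (\<Omega> - closure D)"
    and "k \<noteq> 0"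
    and "A = c *\<^sub>R mat 1"
    and "C2_on (\<Omega> - closure D) w"
    and "\<And>x. x \<in> \<Omega> - closure D \<Longrightarrow> laplacian w x = k"
    and "\<And>p. p \<in> frontier \<Omega> \<Longrightarrow>
           (gradient w \<longlongrightarrow> 0) (at p within (\<Omega> - closure D))"
    and "\<And>p. p \<in> frontier D \<Longrightarrow>
           (gradient w \<longlongrightarrow> A *v p + d) (at p within (\<Omega> - closure D))"
  shows "\<exists>a r R. 0 < r \<and> 0 < R \<and> D = ball a r \<and> \<Omega> = ball a R"
proof -
  define S where "S = \<Omega> - closure D"
  let ?G = "gradient w" and ?J = "\<lambda>x. jacobian (gradient w) (at x)"
  have D: "open D" "bounded D" "D \<noteq> {}" and \<Omega>: "open \<Omega>" "bounded \<Omega>" "\<Omega> \<noteq> {}"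
    using assms(1,3) by (auto simp: bounded_domain_def)
  have S: "open S" "bounded S" "connected S"
    using \<Omega> assms(6) by (auto simp: S_def intro: bounded_subset)
  have pde: "poisson_equation S w ?G ?J k"
  proof
    show "(w has_derivative (\<lambda>h. h \<bullet> ?G x)) (at x)" "(?G has_derivative (\<lambda>h. ?J x *v h)) (at x)"
      "trace (?J x) = k" if "x \<in> S" for x
      using assms(9,10) that gderiv_gradient[of w x] jacobian_works[of ?G "at x"]
      by (auto simp: C2_on_def S_def gderiv_def laplacian_def trace_def)
  qed (rule S)
  have frontier_S: "p \<in> frontier \<Omega> \<or> p \<in> frontier D" if "p \<in> frontier S" for p
  proof -
    have p: "p \<in> closure S" "p \<notin> S"
      using that S(1) by (auto simp: frontier_def interior_open)
    have "D \<inter> closure S = {}"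
      using D(1) closure_subset[of D] by (subst open_Int_closure_eq_empty) (auto simp: S_def)
    moreover have "closure S \<subseteq> closure \<Omega>"
      by (intro closure_mono) (auto simp: S_def)
    ultimately show ?thesis
      using p D(1) \<Omega>(1) by (auto simp: frontier_def interior_open S_def)
  qed
  \<comment> \<open>Since \<open>closure D \<subseteq> \<Omega>\<close>, the sets
    \<open>\<Omega>\<close> and \<open>S\<close> agree near a frontier point of
    \<open>\<Omega>\<close>.\<close>
  have frontier_\<Omega>: "p \<in> frontier S" if "p \<in> frontier \<Omega>" for p
  proof -
    have p: "p \<in> closure \<Omega>" "p \<notin> \<Omega>"
      using that \<Omega>(1) by (auto simp: frontier_def interior_open)
    have "- closure D \<inter> closure \<Omega> \<subseteq> closure (- closure D \<inter> \<Omega>)"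
      by (intro open_Int_closure_subset) auto
    with p assms(5) have "p \<in> closure S"
      by (auto simp: S_def Diff_eq Int_commute)
    with p S(1) show ?thesis
      by (auto simp: frontier_def interior_open S_def)
  qed
  \<comment> \<open>The Lipschitz boundary makes \<open>p\<close> a limit of points outside
    \<open>closure D\<close>, which lie in \<open>\<Omega>\<close> once close to \<open>p\<close>.
    Hence the limit prescribed at \<open>p\<close> is not vacuous.\<close>
  have frontier_D: "p \<in> frontier S" if "p \<in> frontier D" for p
  proof -
    have p: "p \<in> closure D" "p \<in> closure (- closure D)"
      using that lipschitz_boundary_frontier_closure[OF assms(2) D(1)] by (auto simp: frontier_def)
    have "\<Omega> \<inter> closure (- closure D) \<subseteq> closure (\<Omega> \<inter> - closure D)"
      by (intro open_Int_closure_subset \<Omega>)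
    with p assms(5) have "p \<in> closure S"
      by (auto simp: S_def Diff_eq)
    with p S(1) show ?thesis
      by (auto simp: frontier_def interior_open S_def)
  qed
  have lim_\<Omega>: "(?G \<longlongrightarrow> 0) (at p within S)" if "p \<in> frontier \<Omega>" for p
    using assms(11)[OF that] by (simp add: S_def)
  have lim_D: "(?G \<longlongrightarrow> c *\<^sub>R p + d) (at p within S)" if "p \<in> frontier D" for p
    using assms(12)[OF that] by (simp add: S_def assms(8) scaleR_matrix_vector_assoc[symmetric])
  show ?thesis
  proof (cases "c = 0")
    case True
    \<comment> \<open>For \<open>d = 0\<close> any unit vector serves as \<open>n\<close>.\<close>
    obtain n :: "real^3" and t where n: "norm n = 1" "d = t *\<^sub>R n"
    proof (cases "d = 0")
      case True
      with that[of "axis 1 1" 0] show thesis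
        by (simp add: norm_axis_1)
    next
      case False
      with that[of "sgn d" "norm d"] show thesis
        by (simp add: norm_sgn sgn_div_norm)
    qed
    have bdry: "\<exists>b. (?G \<longlongrightarrow> b *\<^sub>R n) (at p within S)" if "p \<in> frontier S" for p
      using frontier_S[OF that] lim_\<Omega>[of p] lim_D[of p] True n(2)
      by (metis add_0 scaleR_zero_left)
    define F where "F = (\<lambda>x. ?G x \<bullet> n - k * (x \<bullet> n))"
    have "(F has_derivative (\<lambda>h. 0)) (at x)" if "x \<in> S" for x
    proof -
      have "(F has_derivative (\<lambda>h. k * (h \<bullet> n) - k * (h \<bullet> n))) (at x)"
        unfolding F_def
        by (intro has_derivative_diff poisson_equation.unidirectional_gradient[OF pde S(2) n(1) bdry that]
            has_derivative_mult_right has_derivative_inner_left has_derivative_ident)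
      then show ?thesis
        by simp
    qed
    then obtain C where C: "\<And>x. x \<in> S \<Longrightarrow> F x = C"
      using has_derivative_zero_unique_connected[OF S(1,3)] by (metis all_not_in_conv)
    \<comment> \<open>The gradient tends to 0 at the outer frontier, so \<open>p \<bullet> n\<close>
      takes the single value \<open>- C / k\<close> there, which no bounded open set
      permits.\<close>
    have const: "- (k * (p \<bullet> n)) = C" if p: "p \<in> frontier \<Omega>" for p
    proof -
      have "at p within S \<noteq> bot"
        using frontier_\<Omega>[OF p] S(1)
        by (simp add: at_within_eq_bot_iff frontier_def interior_open)
      moreover have "(F \<longlongrightarrow> 0 \<bullet> n - k * (p \<bullet> n)) (at p within S)"
        unfolding F_def by (intro tendsto_intros lim_\<Omega>[OF p])
      moreover have "(F \<longlongrightarrow> C) (at p within S)"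
        by (intro tendsto_eventually) (simp add: eventually_at_filter C)
      ultimately have "0 \<bullet> n - k * (p \<bullet> n) = C"
        by (rule tendsto_unique)
      then show ?thesis
        by simp
    qed
    obtain p q where "p \<in> frontier \<Omega>" "q \<in> frontier \<Omega>" "p \<bullet> n < q \<bullet> n"
      using bounded_open_inner_not_constant_on_frontier[OF \<Omega>, of n] n(1) by force
    with const[of p] const[of q] \<open>k \<noteq> 0\<close> show ?thesis
      by auto
  next
    case False
    \<comment> \<open>The center is the zero of the affine field:
      \<open>c *\<^sub>R p + d = c *\<^sub>R (p - a)\<close>.\<close>
    define a where "a = - (1 / c) *\<^sub>R d"
    have lim_D': "(?G \<longlongrightarrow> c *\<^sub>R (p - a)) (at p within S)" if "p \<in> frontier D" for p
      using lim_D[OF that] False by (simp add: a_def algebra_simps)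
    have lim_\<Omega>': "(?G \<longlongrightarrow> 0 *\<^sub>R (p - a)) (at p within S)" if "p \<in> frontier \<Omega>" for p
      using lim_\<Omega>[OF that] by simp
    obtain C where C: "\<And>p b. p \<in> frontier S \<Longrightarrow> (?G \<longlongrightarrow> b *\<^sub>R (p - a)) (at p within S) \<Longrightarrow>
        norm (p - a) ^ 3 * (b - k / 3) = C"
      using radial_frontier_constant[OF pde S(2,3)] frontier_S lim_D' lim_\<Omega>' by metis
    \<comment> \<open>Here \<open>b\<close> is the factor of \<open>p - a\<close> in the boundary
      gradient: 0 on the outer frontier, \<open>c\<close> on the inner one. If it differs from
      \<open>k / 3\<close>, the relation determines \<open>norm (p - a)\<close>.\<close>
    have ball: "\<exists>R. 0 < R \<and> U = ball a R"
      if U: "open U" "bounded U" "U \<noteq> {}" and "b \<noteq> k / 3"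
        and C: "\<And>p. p \<in> frontier U \<Longrightarrow> norm (p - a) ^ 3 * (b - k / 3) = C" for U b
    proof -
      have "norm (p - a) = root 3 (C / (b - k / 3))" if "p \<in> frontier U" for p
        using C[OF that] \<open>b \<noteq> k / 3\<close> by (metis eq_iff_diff_eq_0 nonzero_mult_div_cancel_right
            norm_ge_zero real_root_power_cancel zero_less_numeral)
      then have "frontier U \<subseteq> sphere a (root 3 (C / (b - k / 3)))"
        by (auto simp: dist_norm norm_minus_commute)
      with bounded_open_eq_ball[OF U] show ?thesis
        by auto
    qed
    have C_\<Omega>: "norm (p - a) ^ 3 * (0 - k / 3) = C" if "p \<in> frontier \<Omega>" for p
      using C[OF frontier_\<Omega> lim_\<Omega>'] that by blast
    have C_D: "norm (p - a) ^ 3 * (c - k / 3) = C" if "p \<in> frontier D" for p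
      using C[OF frontier_D lim_D'] that by blast
    obtain R where R: "0 < R" "\<Omega> = ball a R"
      using ball[OF \<Omega> _ C_\<Omega>] \<open>k \<noteq> 0\<close> by auto
    \<comment> \<open>Evaluation at a point of the outer sphere gives
      \<open>C = - k / 3 * R^3\<close>. This is nonzero, whereas \<open>c = k / 3\<close> would
      force \<open>C = 0\<close> on the inner frontier.\<close>
    have "a + R *\<^sub>R axis 1 1 \<in> frontier \<Omega>"
      using R by (simp add: frontier_ball dist_norm norm_axis_1)
    from C_\<Omega>[OF this] have "C \<noteq> 0"
      using R \<open>k \<noteq> 0\<close> by (auto simp: norm_axis_1)
    have "frontier D \<noteq> {}"
      using D by (metis frontier_eq_empty not_bounded_UNIV)
    with C_D \<open>C \<noteq> 0\<close> have "c \<noteq> k / 3"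
      by auto
    with ball[OF D _ C_D] R show ?thesis
      by blast
  qed
qed

end
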